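(* Let $\theta\in(0,2\pi)$ be such that $\cos\theta$ is transcendental. Then for a very general point $\xi\in\mathfrak{C}_\theta$ the holonomy map $\rho_\xi\colon F_2\to \mathrm{PSL}(2,\mathbb{R})$ is faithful (injective); that is, there is a dense $G_\delta$ subset of $\mathfrak{C}_\theta$ such that $\rho_\xi$ is injective for every $\xi$ in it.
   Context: $F_2=\langle X,Y,Z\mid XYZ=1\rangle$ is the free group on $X,Y$, identified with $\pi_1(M)$ for $M$ a once-punctured torus. For $\theta\in(0,2\pi)$, the Fricke--Klein space $\mathfrak{C}_\theta$ of marked incomplete hyperbolic structures on $M$ with a single cone point of angle $\theta$ at the puncture is identified with $$\mathfrak{C}_\theta=\{(x,y,z)\in(2,\infty)^3\mid x^2+y^2+z^2-xyz-2=-2\cos(\theta/2)\}$$ (with the subspace topology), where $x,y,z$ are the absolute values of the traces of the holonomies of $X,Y,Z$. For $\xi=(x,y,z)\in\mathfrak{C}_\theta$ the holonomy map $\rho_\xi\colon F_2\to\mathrm{PSL}(2,\mathbb{R})$ is well defined up to conjugation; up to conjugation by an isometry of $\mathbb{H}^2$ it is the projection to $\mathrm{PSL}(2,\mathbb{R})$ of the representation $\tilde\rho_\xi\colon F_2\to \mathrm{SL}(2,\mathbb{R})$ given by $$\tilde\rho_\xi(X)=\begin{pmatrix}x&-1\\1&0\end{pmatrix},\quad \tilde\rho_\xi(Y)=\begin{pmatrix}0&\zeta^{-1}\\-\zeta&y\end{pmatrix},\quad \zeta\ge1,\ \zeta+\zeta^{-1}=z,$$ for which $\mathrm{tr}\,\tilde\rho_\xi(X)=x$,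 $\mathrm{tr}\,\tilde\rho_\xi(Y)=y$, $\mathrm{tr}\,\tilde\rho_\xi(Z)=z$. A statement holds for a very general point of a topological space $A$ if it holds for all points of some dense $G_\delta$ subset of $A$. *)

theory Defs
  imports
    "HOL-Analysis.Analysis"
    "HOL-Algebra.Algebra"
    "HOL-Computational_Algebra.Polynomial"
begin

section \<open>Very general points\<close>

definition very_general :: "'a topology \<Rightarrow> ('a \<Rightarrow> bool) \<Rightarrow> bool" where
  "very_general T P \<longleftrightarrow>
     (\<exists>G. gdelta_in T G \<and> T closure_of G = topspace T \<and> (\<forall>\<xi>\<in>G. P \<xi>))"


section \<open>Free groups\<close>

text \<open>
  A letter \<open>(g, False)\<close> stands for the generator \<open>g\<close> and \<open>(g, True)\<close> for its inverse.  Elements of the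
  free group are the reduced words, multiplied by concatenation followed by free reduction.
\<close>

type_synonym 'g word = "('g \<times> bool) list"

definition inv_letter :: "'g \<times> bool \<Rightarrow> 'g \<times> bool" where
  "inv_letter a = (fst a, \<not> snd a)"

definition reduced :: "'g word \<Rightarrow> bool" where
  "reduced w \<longleftrightarrow> successively (\<lambda>a b. b \<noteq> inv_letter a) w"

fun push_letter :: "'g \<times> bool \<Rightarrow> 'g word \<Rightarrow> 'g word" where
  "push_letter a [] = [a]"
| "push_letter a (b # w) = (if b = inv_letter a then w else a # b # w)"

definition word_mult :: "'g word \<Rightarrow> 'g word \<Rightarrow> 'g word" where
  "word_mult u v = foldr push_letter u v"

definition free_group :: "'g word monoid" where
  "free_group = \<lparr>carrier = {w. reduced w}, mult = word_mult, one = []\<rparr>"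

lemma inv_letter_inv_letter [simp]: "inv_letter (inv_letter a) = a"
  by (simp add: inv_letter_def)

lemma inv_letter_neq [simp]: "inv_letter a \<noteq> a"
  by (cases a) (simp add: inv_letter_def)

lemma reduced_Nil [simp]: "reduced []"
  by (simp add: reduced_def)

lemma reduced_Cons: "reduced (a # w) \<longleftrightarrow> reduced w \<and> (w = [] \<or> hd w \<noteq> inv_letter a)"
  by (cases w) (auto simp: reduced_def)

lemma reduced_push_letter: "reduced w \<Longrightarrow> reduced (push_letter a w)"
  by (cases w) (auto simp: reduced_Cons)

lemma push_letter_inv_letter: "reduced w \<Longrightarrow> push_letter a (push_letter (inv_letter a) w) = w"
  by (cases w; cases "tl w") (auto simp: reduced_Cons)

lemma reduced_word_mult: "reduced v \<Longrightarrow> reduced (word_mult u v)"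
  unfolding word_mult_def by (induction u) (auto intro: reduced_push_letter)

lemma word_mult_push_letter:
  assumes "reduced w"
  shows "word_mult (push_letter a u) w = push_letter a (word_mult u w)"
proof (cases u)
  case (Cons b u')
  then show ?thesis
    using push_letter_inv_letter[OF reduced_word_mult[OF assms, of u']]
    by (simp add: word_mult_def)
qed (simp add: word_mult_def)

lemma word_mult_assoc:
  assumes "reduced w"
  shows "word_mult (word_mult u v) w = word_mult u (word_mult v w)"
proof (induction u)
  case (Cons a u)
  then show ?case
    using word_mult_push_letter[OF assms, of a "word_mult u v"] by (simp add: word_mult_def)
qed (simp add: word_mult_def)

lemma word_mult_Nil: "reduced u \<Longrightarrow> word_mult u [] = u"
proof (induction u)
  case (Cons a u)
  then have "word_mult u [] = u" by (simp add: reduced_Cons)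
  with Cons.prems show ?case by (cases u) (auto simp: word_mult_def reduced_Cons)
qed (simp add: word_mult_def)

lemma word_left_inverse:
  "\<exists>v. reduced v \<and> word_mult v u = []" if "reduced u"
  using that
proof (induction u)
  case (Cons a u)
  then obtain v where v: "reduced v" "word_mult v u = []" by (auto simp: reduced_Cons)
  define v' where "v' = word_mult v [inv_letter a]"
  have "word_mult v' (a # u) = word_mult v (word_mult [inv_letter a] (a # u))"
    unfolding v'_def by (rule word_mult_assoc[OF Cons.prems])
  also have "\<dots> = []" using v by (simp add: word_mult_def)
  finally have "word_mult v' (a # u) = []" .
  moreover have "reduced v'"
    unfolding v'_def by (rule reduced_word_mult) (simp add: reduced_Cons)
  ultimately show ?case by blast
qed (auto simp: word_mult_def intro: exI[of _ "[]"])

lemma group_free_group: "group free_group"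
proof (rule groupI)
  fix u v w :: "'g word"
  assume "u \<in> carrier free_group" "v \<in> carrier free_group" "w \<in> carrier free_group"
  then show "u \<otimes>\<^bsub>free_group\<^esub> v \<otimes>\<^bsub>free_group\<^esub> w = u \<otimes>\<^bsub>free_group\<^esub> (v \<otimes>\<^bsub>free_group\<^esub> w)"
    by (simp add: free_group_def word_mult_assoc)
next
  fix u :: "'g word"
  assume "u \<in> carrier free_group"
  then show "\<exists>v\<in>carrier free_group. v \<otimes>\<^bsub>free_group\<^esub> u = \<one>\<^bsub>free_group\<^esub>"
    using word_left_inverse[of u] by (auto simp: free_group_def)
qed (auto simp: free_group_def reduced_word_mult, simp add: word_mult_def)

text \<open>The homomorphism out of the free group extending a map on the generators.\<close>

definition letter_image :: "('a, 'b) monoid_scheme \<Rightarrow> ('g \<Rightarrow> 'a) \<Rightarrow> 'g \<times> bool \<Rightarrow> 'a" where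
  "letter_image G f a = (if snd a then inv\<^bsub>G\<^esub> (f (fst a)) else f (fst a))"

definition free_lift :: "('a, 'b) monoid_scheme \<Rightarrow> ('g \<Rightarrow> 'a) \<Rightarrow> 'g word \<Rightarrow> 'a" where
  "free_lift G f w = foldr (\<lambda>a r. letter_image G f a \<otimes>\<^bsub>G\<^esub> r) w \<one>\<^bsub>G\<^esub>"

lemma free_lift_hom:
  assumes "group G" and f: "\<And>g. f g \<in> carrier G"
  shows "free_lift G f \<in> hom free_group G"
proof -
  interpret group G by fact
  let ?h = "free_lift G f"
  have l [simp]: "letter_image G f a \<in> carrier G" for a
    using f by (simp add: letter_image_def)
  have c [simp]: "?h w \<in> carrier G" for w
    by (induction w) (simp_all add: free_lift_def)
  have i: "letter_image G f (inv_letter a) = inv\<^bsub>G\<^esub> (letter_image G f a)" for a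
    using f by (simp add: letter_image_def inv_letter_def)
  have C: "?h (a # w) = letter_image G f a \<otimes>\<^bsub>G\<^esub> ?h w" for a w
    by (simp add: free_lift_def)
  have p: "?h (push_letter a w) = letter_image G f a \<otimes>\<^bsub>G\<^esub> ?h w" for a w
    by (cases w) (auto simp: C i m_assoc[symmetric] r_inv)
  have "?h (word_mult u v) = ?h u \<otimes>\<^bsub>G\<^esub> ?h v" for u v
  proof (induction u)
    case Nil
    then show ?case by (simp add: word_mult_def) (simp add: free_lift_def)
  next
    case (Cons a u)
    have "word_mult (a # u) v = push_letter a (word_mult u v)" by (simp add: word_mult_def)
    then show ?case using Cons by (simp add: p C m_assoc)
  qed
  then show ?thesis by (auto intro!: homI simp: free_group_def)
qed

lemma free_lift_generator:
  assumes "group G" and "f g \<in> carrier G"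
  shows "free_lift G f [(g, False)] = f g"
proof -
  interpret group G by fact
  show ?thesis using assms(2) by (simp add: free_lift_def letter_image_def)
qed


section \<open>The group \<open>F\<^sub>2\<close>\<close>

datatype gen = GenX | GenY

abbreviation F2 :: "gen word monoid" where
  "F2 \<equiv> free_group"

definition X_F2 :: "gen word" where "X_F2 = [(GenX, False)]"
definition Y_F2 :: "gen word" where "Y_F2 = [(GenY, False)]"
definition Z_F2 :: "gen word" where "Z_F2 = inv\<^bsub>F2\<^esub> (X_F2 \<otimes>\<^bsub>F2\<^esub> Y_F2)"

lemma F2_generators_closed [simp]:
  "X_F2 \<in> carrier F2" "Y_F2 \<in> carrier F2" "Z_F2 \<in> carrier F2"
proof -
  interpret group F2 by (rule group_free_group)
  show x: "X_F2 \<in> carrier F2" and y: "Y_F2 \<in> carrier F2"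
    by (simp_all add: X_F2_def Y_F2_def free_group_def reduced_Cons)
  show "Z_F2 \<in> carrier F2" using x y by (simp add: Z_F2_def)
qed

lemma F2_relation: "X_F2 \<otimes>\<^bsub>F2\<^esub> Y_F2 \<otimes>\<^bsub>F2\<^esub> Z_F2 = \<one>\<^bsub>F2\<^esub>"
proof -
  interpret group F2 by (rule group_free_group)
  show ?thesis by (simp add: Z_F2_def r_inv)
qed


section \<open>\<open>SL(2,\<real>)\<close> and \<open>PSL(2,\<real>)\<close>\<close>

definition SL2R :: "(real^2^2) monoid" where
  "SL2R = \<lparr>carrier = {A. det A = 1}, mult = (**), one = mat 1\<rparr>"

definition pm_id :: "(real^2^2) set" where
  "pm_id = {mat 1, - mat 1}"

definition PSL2R :: "(real^2^2) set monoid" where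
  "PSL2R = SL2R Mod pm_id"

definition proj_PSL2R :: "real^2^2 \<Rightarrow> (real^2^2) set" where
  "proj_PSL2R A = pm_id #>\<^bsub>SL2R\<^esub> A"

lemma group_SL2R: "group SL2R"
proof (rule groupI)
  fix A :: "real^2^2"
  assume "A \<in> carrier SL2R"
  then have d: "det A = 1" by (simp add: SL2R_def)
  then have "invertible A" by (simp add: invertible_det_nz)
  then obtain B where m: "B ** A = mat 1" by (auto simp: invertible_def)
  then have "det B * det A = 1" by (metis det_mul det_I)
  with d m show "\<exists>B\<in>carrier SL2R. B \<otimes>\<^bsub>SL2R\<^esub> A = \<one>\<^bsub>SL2R\<^esub>"
    by (auto simp: SL2R_def)
qed (auto simp: SL2R_def det_mul matrix_mul_assoc)

lemma normal_pm_id: "pm_id \<lhd> SL2R"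
proof -
  interpret group SL2R by (rule group_SL2R)
  have d: "det (- mat 1 :: real^2^2) = 1" by (simp add: det_2 mat_def)
  have m: "(- mat 1) ** A = - A" "A ** (- mat 1) = - A" for A :: "real^2^2"
    by (simp_all add: vec_eq_iff forall_2 matrix_matrix_mult_def sum_2 mat_def)
  have i: "inv\<^bsub>SL2R\<^esub> (- mat 1) = - mat 1"
    by (rule inv_equality) (simp_all add: SL2R_def d m)
  have o: "\<one>\<^bsub>SL2R\<^esub> = mat 1" by (simp add: SL2R_def)
  have "subgroup pm_id SL2R"
    using i inv_one unfolding o
    by unfold_locales (auto simp: pm_id_def SL2R_def d m)
  moreover have "pm_id #>\<^bsub>SL2R\<^esub> A = A <#\<^bsub>SL2R\<^esub> pm_id" if "A \<in> carrier SL2R" for A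
    by (auto simp: r_coset_def l_coset_def pm_id_def SL2R_def m)
  ultimately show ?thesis by (simp add: normal_def normal_axioms_def is_group)
qed

lemma group_PSL2R: "group PSL2R"
  unfolding PSL2R_def by (rule normal.factorgroup_is_group[OF normal_pm_id])

lemma proj_PSL2R_hom: "proj_PSL2R \<in> hom SL2R PSL2R"
  unfolding PSL2R_def proj_PSL2R_def by (rule normal.r_coset_hom_Mod[OF normal_pm_id])


section \<open>Fricke--Klein space and the holonomy map\<close>

definition fricke_klein :: "real \<Rightarrow> (real \<times> real \<times> real) set" where
  "fricke_klein \<theta> = {(x, y, z). x > 2 \<and> y > 2 \<and> z > 2 \<and>
     x\<^sup>2 + y\<^sup>2 + z\<^sup>2 - x * y * z - 2 = - 2 * cos (\<theta> / 2)}"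

definition zeta :: "real \<Rightarrow> real" where
  "zeta z = (THE s. s \<ge> 1 \<and> s + inverse s = z)"

lemma zeta_unique:
  assumes "z \<ge> 2"
  shows "\<exists>!s::real. s \<ge> 1 \<and> s + inverse s = z"
proof (rule ex_ex1I)
  let ?s = "(z + sqrt (z\<^sup>2 - 4)) / 2"
  have "z\<^sup>2 \<ge> 4" using power_mono[of 2 z 2] assms by simp
  then have q: "sqrt (z\<^sup>2 - 4) ^ 2 = z\<^sup>2 - 4" "sqrt (z\<^sup>2 - 4) \<ge> 0" by simp_all
  have s: "?s \<ge> 1" using add_mono[OF assms q(2)] by simp
  have "?s * (z - ?s) = 1" using q(1) by (simp add: field_simps power2_eq_square)
  with s have "inverse ?s = z - ?s" by (intro inverse_unique) 
  with s show "\<exists>s::real. s \<ge> 1 \<and> s + inverse s = z" by (intro exI[of _ ?s]) auto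
next
  fix s t :: real
  assume st: "s \<ge> 1 \<and> s + inverse s = z" "t \<ge> 1 \<and> t + inverse t = z"
  then have "s + inverse s = t + inverse t" "s > 0" "t > 0" by auto
  then have "(s - t) * (s * t - 1) = 0" by (simp add: field_simps)
  moreover have "s = t" if "s * t = 1"
  proof -
    have "s * 1 \<le> s * t" "1 * t \<le> s * t" using st by (auto intro!: mult_left_mono mult_right_mono)
    with that st show ?thesis by auto
  qed
  ultimately show "s = t" by auto
qed

lemma zeta:
  assumes "z \<ge> 2"
  shows "zeta z \<ge> 1" "zeta z + inverse (zeta z) = z"
  using theI'[OF zeta_unique[OF assms]] by (simp_all add: zeta_def)

fun gen_image :: "real \<times> real \<times> real \<Rightarrow> gen \<Rightarrow> real^2^2" where
  "gen_image (x, y, z) GenX = vector [vector [x, -1], vector [1, 0]]"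
| "gen_image (x, y, z) GenY = vector [vector [0, inverse (zeta z)], vector [- zeta z, y]]"

definition holonomy_SL :: "real \<times> real \<times> real \<Rightarrow> gen word \<Rightarrow> real^2^2" where
  "holonomy_SL \<xi> = free_lift SL2R (gen_image \<xi>)"

text \<open>
  The holonomy of a marked structure is only defined up to conjugation; this is the representative
  normalised by the explicit matrices above.  Injectivity does not depend on the representative.
\<close>

definition holonomy :: "real \<times> real \<times> real \<Rightarrow> gen word \<Rightarrow> (real^2^2) set" where
  "holonomy \<xi> w = proj_PSL2R (holonomy_SL \<xi> w)"

lemma gen_image_closed:
  assumes "z \<ge> 2"
  shows "gen_image (x, y, z) g \<in> carrier SL2R"
  using zeta(1)[OF assms] by (cases g) (simp_all add: SL2R_def det_2)

lemma holonomy_SL_hom: "z \<ge> 2 \<Longrightarrow> holonomy_SL (x, y, z) \<in> hom F2 SL2R"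
  unfolding holonomy_SL_def by (intro free_lift_hom group_SL2R gen_image_closed)

lemma holonomy_hom: "z \<ge> 2 \<Longrightarrow> holonomy (x, y, z) \<in> hom F2 PSL2R"
  using hom_compose[OF holonomy_SL_hom proj_PSL2R_hom, of z x y]
  by (simp add: holonomy_def[abs_def] comp_def)

lemma trace_holonomy_SL:
  assumes "z \<ge> 2"
  shows "trace (holonomy_SL (x, y, z) X_F2) = x"
    and "trace (holonomy_SL (x, y, z) Y_F2) = y"
    and "trace (holonomy_SL (x, y, z) Z_F2) = z"
proof -
  let ?r = "holonomy_SL (x, y, z)"
  interpret F: group F2 by (rule group_free_group)
  interpret S: group SL2R by (rule group_SL2R)
  interpret group_hom F2 SL2R ?r
    by unfold_locales (rule holonomy_SL_hom[OF assms])
  note g = gen_image_closed[OF assms]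
  have X: "?r X_F2 = gen_image (x, y, z) GenX" and Y: "?r Y_F2 = gen_image (x, y, z) GenY"
    unfolding holonomy_SL_def X_F2_def Y_F2_def
    by (intro free_lift_generator group_SL2R g)+
  show "trace (?r X_F2) = x" "trace (?r Y_F2) = y"
    unfolding X Y by (simp_all add: trace_def sum_2)
  define B :: "real^2^2" where
    "B = vector [vector [inverse (zeta z), y - x * inverse (zeta z)], vector [0, zeta z]]"
  have nz: "zeta z \<noteq> 0" using zeta(1)[OF assms] by auto
  have "inv\<^bsub>SL2R\<^esub> (gen_image (x, y, z) GenX \<otimes>\<^bsub>SL2R\<^esub> gen_image (x, y, z) GenY) = B"
  proof (rule S.inv_equality)
    show "B \<otimes>\<^bsub>SL2R\<^esub> (gen_image (x, y, z) GenX \<otimes>\<^bsub>SL2R\<^esub> gen_image (x, y, z) GenY) = \<one>\<^bsub>SL2R\<^esub>"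
      using nz by (simp add: SL2R_def B_def vec_eq_iff forall_2 matrix_matrix_mult_def sum_2 mat_def
          field_simps)
    show "gen_image (x, y, z) GenX \<otimes>\<^bsub>SL2R\<^esub> gen_image (x, y, z) GenY \<in> carrier SL2R"
      by (intro S.m_closed g)
    show "B \<in> carrier SL2R" using nz by (simp add: SL2R_def B_def det_2)
  qed
  then have "?r Z_F2 = B" by (simp add: Z_F2_def X Y)
  then show "trace (?r Z_F2) = z"
    using zeta(2)[OF assms] by (simp add: B_def trace_def sum_2)
qed

end

theory Submission
  imports Defs "HOL-Algebra.Algebraic_Closure_Type"
begin

text \<open>
  If \<open>x, y, \<zeta>\<close> are algebraically independent over \<open>\<rat>\<close>, then a word whose matrix is \<open>\<plusminus>1\<close> at
  \<open>(x, y, \<zeta>)\<close> has that matrix for all parameters, because the entries are Laurent polynomials;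
  the parameters \<open>(10, 5/2, 8)\<close>, where the two matrices play ping-pong, rule this out for a reduced
  nonempty word.  Independence is obtained from that of \<open>x, y, k\<close> with \<open>k = - 2 cos (\<theta>/2)\<close>, since
  \<open>k\<close> is algebraic over \<open>\<rat>(x, y, \<zeta>)\<close>.  As \<open>k\<close> is transcendental, an exchange argument shows that only
  countably many \<open>x\<close>, and for each other \<open>x\<close> only countably many \<open>y\<close>, violate this, so such
  points are dense in the surface.  Each word is nontrivial on an open set of
  points, and there are countably many words.
\<close>

section \<open>Algebraic elements over subrings of a field\<close>

definition poly_over :: "'a::field set \<Rightarrow> 'a poly \<Rightarrow> bool" where
  "poly_over S p \<longleftrightarrow> (\<forall>i. Polynomial.coeff p i \<in> S)"

text \<open>Subrings suffice as a base: by \<open>algebraic_over_fractions\<close> the notion agrees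
  with that over the fractions, so rings such as Q[x] stand in for function fields.\<close>

definition algebraic_over :: "'a::field set \<Rightarrow> 'a \<Rightarrow> bool" where
  "algebraic_over S x \<longleftrightarrow> (\<exists>p. poly_over S p \<and> p \<noteq> 0 \<and> poly p x = 0)"

definition adjoin :: "'a::field set \<Rightarrow> 'a \<Rightarrow> 'a set" where
  "adjoin S x = {poly p x |p. poly_over S p}"

text \<open>A zero denominator is harmless: \<open>a / 0\<close> is 0, which a subring contains
  anyway.\<close>

definition fractions :: "'a::field set \<Rightarrow> 'a set" where
  "fractions S = {a / b |a b. a \<in> S \<and> b \<in> S}"

lemma algebraic_over_mono: "algebraic_over S x \<Longrightarrow> S \<subseteq> T \<Longrightarrow> algebraic_over T x"
  unfolding algebraic_over_def poly_over_def by blast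

lemma algebraic_over_Rats: "algebraic_over \<rat> x \<longleftrightarrow> algebraic x" for x :: real
  unfolding algebraic_over_def poly_over_def algebraic_altdef by (rule refl)

locale field_subring =
  fixes S :: "'a::field set"
  assumes zero_mem [simp]: "0 \<in> S" and one_mem [simp]: "1 \<in> S"
    and uminus_mem [simp]: "a \<in> S \<Longrightarrow> - a \<in> S"
    and add_mem [simp]: "a \<in> S \<Longrightarrow> b \<in> S \<Longrightarrow> a + b \<in> S"
    and mult_mem [simp]: "a \<in> S \<Longrightarrow> b \<in> S \<Longrightarrow> a * b \<in> S"
begin

lemma diff_mem [simp]: "a \<in> S \<Longrightarrow> b \<in> S \<Longrightarrow> a - b \<in> S"
  using add_mem[of a "- b"] by simp

lemma sum_mem: "(\<And>i. i \<in> I \<Longrightarrow> f i \<in> S) \<Longrightarrow> sum f I \<in> S"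
  by (induction I rule: infinite_finite_induct) auto

lemma poly_over_0 [simp]: "poly_over S 0"
  by (simp add: poly_over_def)

lemma poly_over_pCons [simp]: "poly_over S (pCons a p) \<longleftrightarrow> a \<in> S \<and> poly_over S p"
proof
  assume *: "poly_over S (pCons a p)"
  show "a \<in> S \<and> poly_over S p"
    using *[unfolded poly_over_def, rule_format, of 0] *[unfolded poly_over_def, rule_format, of "Suc _"]
    by (auto simp: poly_over_def)
qed (auto simp: poly_over_def coeff_pCons split: nat.split)

lemma poly_over_1 [simp]: "poly_over S 1"
  by (simp add: one_pCons)

lemma poly_over_add [simp]: "poly_over S p \<Longrightarrow> poly_over S q \<Longrightarrow> poly_over S (p + q)"
  by (simp add: poly_over_def)

lemma poly_over_diff [simp]: "poly_over S p \<Longrightarrow> poly_over S q \<Longrightarrow> poly_over S (p - q)"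
  by (simp add: poly_over_def)

lemma poly_over_uminus [simp]: "poly_over S p \<Longrightarrow> poly_over S (- p)"
  by (simp add: poly_over_def)

lemma poly_over_mult [simp]: "poly_over S p \<Longrightarrow> poly_over S q \<Longrightarrow> poly_over S (p * q)"
  by (auto simp: poly_over_def coeff_mult intro!: sum_mem)

lemma poly_over_smult [simp]: "c \<in> S \<Longrightarrow> poly_over S p \<Longrightarrow> poly_over S (Polynomial.smult c p)"
  by (simp add: poly_over_def)

lemma poly_over_monom [simp]: "c \<in> S \<Longrightarrow> poly_over S (Polynomial.monom c n)"
  by (simp add: poly_over_def)

section \<open>Countability of polynomials, adjunctions and algebraic elements\<close>

lemma poly_over_eq_image: "{p. poly_over S p} = Poly ` lists S"
proof (intro equalityI subsetI)
  fix p assume "p \<in> {p. poly_over S p}"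
  then have "coeffs p \<in> lists S"
    by (auto simp: poly_over_def coeffs_def)
  then show "p \<in> Poly ` lists S"
    by (metis Poly_coeffs image_eqI)
next
  fix p assume "p \<in> Poly ` lists S"
  then obtain cs where "p = Poly cs" "cs \<in> lists S" by blast
  then show "p \<in> {p. poly_over S p}"
    by (auto simp: poly_over_def nth_default_def)
qed

lemma countable_poly_over: "countable S \<Longrightarrow> countable {p. poly_over S p}"
  unfolding poly_over_eq_image by auto

lemma countable_adjoin:
  assumes "countable S"
  shows "countable (adjoin S x)"
proof -
  have "adjoin S x = (\<lambda>p. poly p x) ` {p. poly_over S p}"
    by (auto simp: adjoin_def)
  then show ?thesis using countable_poly_over[OF assms] by simp
qed

lemma countable_algebraic_over:
  assumes "countable S"
  shows "countable {x. algebraic_over S x}"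
proof -
  have "{x. algebraic_over S x} = (\<Union>p\<in>{p. poly_over S p} - {0}. {x. poly p x = 0})"
    by (auto simp: algebraic_over_def)
  moreover have "countable {x. poly p x = 0}" if "p \<noteq> 0" for p :: "'a poly"
    using poly_roots_finite[OF that] by (rule countable_finite)
  ultimately show ?thesis
    using countable_poly_over[OF assms] by (auto intro: countable_UN)
qed

section \<open>Adjoining an element and forming fractions\<close>

lemma mem_adjoin: "a \<in> S \<Longrightarrow> a \<in> adjoin S x"
  unfolding adjoin_def by (force intro: exI[of _ "[:a:]"])

lemma generator_mem_adjoin: "x \<in> adjoin S x"
  unfolding adjoin_def by (force intro: exI[of _ "[:0, 1:]"])

lemma field_subring_adjoin: "field_subring (adjoin S x)"
proof
  show "0 \<in> adjoin S x" "1 \<in> adjoin S x" by (simp_all add: mem_adjoin)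
next
  fix a b assume "a \<in> adjoin S x" "b \<in> adjoin S x"
  then obtain p q where "poly_over S p" "a = poly p x" "poly_over S q" "b = poly q x"
    by (auto simp: adjoin_def)
  then show "- a \<in> adjoin S x" "a + b \<in> adjoin S x" "a * b \<in> adjoin S x"
    unfolding adjoin_def
    by (force intro: exI[of _ "- p"] exI[of _ "p + q"] exI[of _ "p * q"])+
qed

lemma mem_fractions: "a \<in> S \<Longrightarrow> a \<in> fractions S"
  unfolding fractions_def by (force intro: exI[of _ a] exI[of _ 1])

lemma fractionsE:
  assumes "a \<in> fractions S"
  obtains u v where "u \<in> S" "v \<in> S" "v \<noteq> 0" "a = u / v"
proof -
  from assms obtain u v where uv: "u \<in> S" "v \<in> S" "a = u / v" by (auto simp: fractions_def)
  show ?thesis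
  proof (cases "v = 0")
    case True
    then show ?thesis using uv that[of 0 1] by simp
  next
    case False
    then show ?thesis using uv that[of u v] by simp
  qed
qed

lemma fractionsI: "u \<in> S \<Longrightarrow> v \<in> S \<Longrightarrow> a = u / v \<Longrightarrow> a \<in> fractions S"
  by (auto simp: fractions_def)

lemma field_subring_fractions: "field_subring (fractions S)"
proof
  show "0 \<in> fractions S" "1 \<in> fractions S" by (simp_all add: mem_fractions)
next
  fix a b assume "a \<in> fractions S" "b \<in> fractions S"
  then obtain u v s t where *: "u \<in> S" "v \<in> S" "v \<noteq> 0" "a = u / v" "s \<in> S" "t \<in> S" "t \<noteq> 0" "b = s / t"
    by (metis fractionsE)
  show "- a \<in> fractions S" using * by (intro fractionsI[of "- u" v]) auto
  show "a + b \<in> fractions S"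
    using * by (intro fractionsI[of "u * t + s * v" "v * t"]) (auto simp: field_simps)
  show "a * b \<in> fractions S" using * by (intro fractionsI[of "u * s" "v * t"]) auto
qed

lemma inverse_mem_fractions: "a \<in> fractions S \<Longrightarrow> inverse a \<in> fractions S"
  by (elim fractionsE) (auto intro: fractionsI)

text \<open>The denominators of the coefficients are multiplied together, one coefficient at a
  time.\<close>

lemma clear_denominators:
  assumes "poly_over (fractions S) p"
  shows "\<exists>d\<in>S. d \<noteq> 0 \<and> poly_over S (Polynomial.smult d p)"
  using assms
proof (induction p)
  case 0
  show ?case by (intro bexI[of _ 1]) auto
next
  case (pCons a p)
  interpret F: field_subring "fractions S" by (rule field_subring_fractions)
  from pCons obtain d where d: "d \<in> S" "d \<noteq> 0" "poly_over S (Polynomial.smult d p)" by auto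
  from pCons obtain u v where uv: "u \<in> S" "v \<in> S" "v \<noteq> 0" "a = u / v" by (auto elim: fractionsE)
  have "poly_over S (Polynomial.smult (v * d) p)" using poly_over_smult[OF uv(2) d(3)] by simp
  moreover have "(v * d) * a \<in> S" using uv d by (simp add: ac_simps)
  ultimately show ?case using uv d by (intro bexI[of _ "v * d"]) auto
qed

lemma algebraic_over_fractions: "algebraic_over (fractions S) x \<longleftrightarrow> algebraic_over S x"
proof
  assume "algebraic_over (fractions S) x"
  then obtain p where p: "poly_over (fractions S) p" "p \<noteq> 0" "poly p x = 0"
    by (auto simp: algebraic_over_def)
  with clear_denominators obtain d where "d \<in> S" "d \<noteq> 0" "poly_over S (Polynomial.smult d p)" by blast
  with p show "algebraic_over S x"
    unfolding algebraic_over_def by (intro exI[of _ "Polynomial.smult d p"]) auto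
next
  assume "algebraic_over S x"
  then show "algebraic_over (fractions S) x"
    by (rule algebraic_over_mono) (auto simp: mem_fractions)
qed

lemma algebraic_over_base: "a \<in> S \<Longrightarrow> algebraic_over S a"
  unfolding algebraic_over_def by (intro exI[of _ "[:- a, 1:]"]) auto

end

section \<open>The algebraic elements form a field, by transfer from HOL-Algebra\<close>

abbreviation type_ring :: "'a::field ring" where
  "type_ring \<equiv> ring_of_type_algebra"

lemma type_ring_simps [simp]:
  "carrier type_ring = UNIV" "x \<otimes>\<^bsub>type_ring\<^esub> y = x * y" "x \<oplus>\<^bsub>type_ring\<^esub> y = x + y"
  "\<one>\<^bsub>type_ring\<^esub> = 1" "\<zero>\<^bsub>type_ring\<^esub> = 0"
  by (simp_all add: ring_of_type_algebra_def)

lemma type_ring_a_inv [simp]: "\<ominus>\<^bsub>type_ring\<^esub> x = - x" for x :: "'a::field"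
proof -
  interpret R: field "type_ring :: 'a ring" by (rule field_from_type_algebra)
  show ?thesis by (rule R.minus_equality) auto
qed

lemma type_ring_m_inv [simp]: "x \<noteq> 0 \<Longrightarrow> inv\<^bsub>type_ring\<^esub> x = inverse x" for x :: "'a::field"
proof -
  interpret R: field "type_ring :: 'a ring" by (rule field_from_type_algebra)
  show "x \<noteq> 0 \<Longrightarrow> ?thesis" by (rule R.comm_inv_char) auto
qed

lemma type_ring_nat_pow [simp]: "x [^]\<^bsub>type_ring\<^esub> (n :: nat) = x ^ n" for x :: "'a::field"
  by (induction n) (simp_all add: nat_pow_def mult.commute)

text \<open>HOL-Algebra lists coefficients from the leading one down, \<open>Poly\<close> from the
  constant one up; hence \<open>rev\<close> here and below.\<close>

lemma type_ring_eval: "ring.eval type_ring ps x = poly (Poly (rev ps)) x" for x :: "'a::field"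
proof -
  interpret R: field "type_ring :: 'a ring" by (rule field_from_type_algebra)
  show ?thesis by (induction ps) (simp_all add: Poly_append poly_monom)
qed

context field_subring
begin

text \<open>The two notions of algebraicity are matched, so that
  \<open>subfield_of_algebraics\<close> applies. That result takes a subfield as base, whence the
  assumption on inverses.\<close>

lemma subfield_algebraic_over_aux:
  assumes inv: "\<And>a. a \<in> S \<Longrightarrow> inverse a \<in> S"
  shows "subfield {x. algebraic_over S x} type_ring"
proof -
  interpret R: field "type_ring :: 'a ring" by (rule field_from_type_algebra)
  have S: "subfield S type_ring"
    by (rule R.subfieldI'[OF R.subringI]) (auto simp: inv)
  have "(R.algebraic over S) x \<longleftrightarrow> algebraic_over S x" for x
  proof
    assume "(R.algebraic over S) x"
    then obtain p where p: "p \<in> carrier (S [X]\<^bsub>type_ring\<^esub>)" "p \<noteq> []" "R.eval p x = 0"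
      using R.algebraicE[OF subfieldE(1)[OF S], of x] by auto
    then have "polynomial\<^bsub>type_ring\<^esub> S p" by (simp add: univ_poly_carrier)
    then have *: "set p \<subseteq> S" "hd p \<noteq> 0" using p(2) by (auto simp: polynomial_def)
    have "Poly (rev p) \<in> {p. poly_over S p}"
      unfolding poly_over_eq_image using * by (intro imageI) auto
    then have "poly_over S (Poly (rev p))" by simp
    moreover have "Poly (rev p) \<noteq> 0"
    proof
      assume "Poly (rev p) = 0"
      then obtain n where n: "rev p = replicate n 0" by (auto simp: Poly_eq_0)
      have "hd p \<in> set (rev p)" using p(2) by simp
      then have "hd p \<in> set (replicate n 0)" unfolding n .
      with *(2) show False by auto
    qed
    ultimately show "algebraic_over S x"
      using p(3) by (auto simp: algebraic_over_def type_ring_eval)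
  next
    assume "algebraic_over S x"
    then obtain p where p: "poly_over S p" "p \<noteq> 0" "poly p x = 0" by (auto simp: algebraic_over_def)
    have "polynomial\<^bsub>type_ring\<^esub> S (rev (coeffs p))"
      using p last_coeffs_eq_coeff_degree[of p]
      by (auto simp: polynomial_def hd_rev poly_over_def coeffs_def)
    then show "(R.algebraic over S) x"
      using p by (intro R.algebraicI[of "rev (coeffs p)"])
        (auto simp: univ_poly_carrier type_ring_eval)
  qed
  then show ?thesis using R.subfield_of_algebraics[OF S] by simp
qed

text \<open>Passing to \<open>fractions S\<close> supplies inverses without changing which elements
  are algebraic.\<close>

lemma subfield_algebraic_over: "subfield {x. algebraic_over S x} type_ring"
proof -
  interpret F: field_subring "fractions S" by (rule field_subring_fractions)
  show ?thesis
    using F.subfield_algebraic_over_aux[OF inverse_mem_fractions] by (simp add: algebraic_over_fractions)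
qed

lemma algebraic_over_closed:
  shows "algebraic_over S x \<Longrightarrow> algebraic_over S y \<Longrightarrow> algebraic_over S (x + y)"
    and "algebraic_over S x \<Longrightarrow> algebraic_over S y \<Longrightarrow> algebraic_over S (x * y)"
    and "algebraic_over S x \<Longrightarrow> algebraic_over S (- x)"
    and "algebraic_over S x \<Longrightarrow> algebraic_over S (inverse x)"
proof -
  interpret R: field "type_ring :: 'a ring" by (rule field_from_type_algebra)
  note sf = subfield_algebraic_over
  note sr = subfieldE(1)[OF sf]
  show "algebraic_over S x \<Longrightarrow> algebraic_over S y \<Longrightarrow> algebraic_over S (x + y)"
    using subringE(7)[OF sr, of x y] by simp
  show "algebraic_over S x \<Longrightarrow> algebraic_over S y \<Longrightarrow> algebraic_over S (x * y)"
    using subringE(6)[OF sr, of x y] by simp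
  show "algebraic_over S x \<Longrightarrow> algebraic_over S (- x)"
    using subringE(5)[OF sr, of x] by simp
  show "algebraic_over S x \<Longrightarrow> algebraic_over S (inverse x)"
    using R.subfield_m_inv(1)[OF sf, of x] by (cases "x = 0") auto
qed

text \<open>
  A list of coefficients in \<open>S[y]\<close> for a polynomial that vanishes at \<open>c\<close> is read instead as a
  polynomial in \<open>y\<close> with coefficients in \<open>S[c]\<close>; this is nonzero since \<open>c\<close> is transcendental, so it
  has only finitely many roots \<open>y\<close>.
\<close>

lemma countable_exchange:
  assumes "countable S" and c: "\<not> algebraic_over S c"
  shows "countable {y. algebraic_over (adjoin S y) c}"
proof -
  \<comment> \<open>\<open>F qs\<close> is the sum of the i-th entry of \<open>qs\<close> times
    \<open>c ^ i\<close>, by Horner's scheme.\<close>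
  define F :: "'a poly list \<Rightarrow> 'a poly" where "F = (\<lambda>qs. foldr (\<lambda>q r. q + Polynomial.smult c r) qs 0)"
  let ?L = "lists {p. poly_over S p}"
  have coeff_F: "Polynomial.coeff (F qs) j = poly (Poly (map (\<lambda>q. Polynomial.coeff q j) qs)) c" for qs j
    by (induction qs) (auto simp: F_def)
  have poly_F: "poly (F qs) y = poly (Poly (map (\<lambda>q. poly q y) qs)) c" for qs y
    by (induction qs) (auto simp: F_def)
  have F_nonzero: "F qs \<noteq> 0" if qs: "qs \<in> ?L" and "Poly (map (\<lambda>q. poly q y) qs) \<noteq> 0" for qs y
  proof
    assume "F qs = 0"
    \<comment> \<open>The coefficient of degree \<open>j\<close> in \<open>F qs\<close> is a
      polynomial over \<open>S\<close> evaluated at \<open>c\<close>; transcendence of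
      \<open>c\<close> turns its vanishing into vanishing of that polynomial.\<close>
    have "Poly (map (\<lambda>q. Polynomial.coeff q j) qs) = 0" for j
    proof (rule ccontr)
      assume "Poly (map (\<lambda>q. Polynomial.coeff q j) qs) \<noteq> 0"
      moreover have "poly_over S (Poly (map (\<lambda>q. Polynomial.coeff q j) qs))"
        using qs by (auto simp: poly_over_def nth_default_def)
      moreover have "poly (Poly (map (\<lambda>q. Polynomial.coeff q j) qs)) c = 0"
        using coeff_F[of qs j] \<open>F qs = 0\<close> by simp
      ultimately show False using c by (auto simp: algebraic_over_def)
    qed
    then have "\<forall>q\<in>set qs. Polynomial.coeff q j = 0" for j
      by (metis Poly_eq_0 length_map in_set_replicate list.set_map imageI)
    then have "\<forall>q\<in>set qs. q = 0" by (metis leading_coeff_0_iff)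
    then have "Poly (map (\<lambda>q. poly q y) qs) = 0" by (induction qs) auto
    with that(2) show False by simp
  qed
  have "{y. algebraic_over (adjoin S y) c} \<subseteq> (\<Union>qs\<in>{qs\<in>?L. F qs \<noteq> 0}. {y. poly (F qs) y = 0})"
  proof
    fix y assume "y \<in> {y. algebraic_over (adjoin S y) c}"
    then obtain p where p: "poly_over (adjoin S y) p" "p \<noteq> 0" "poly p c = 0"
      by (auto simp: algebraic_over_def)
    then have "Polynomial.coeff p i \<in> adjoin S y" for i by (simp add: poly_over_def)
    then have "\<exists>q. poly_over S q \<and> Polynomial.coeff p i = poly q y" for i by (auto simp: adjoin_def)
    then obtain q where q: "\<And>i. poly_over S (q i)" "\<And>i. Polynomial.coeff p i = poly (q i) y"
      by metis
    define qs where "qs = map q [0..<Suc (Polynomial.degree p)]"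
    have "map (\<lambda>q. poly q y) qs = coeffs p"
      using p(2) q(2) by (auto simp: qs_def coeffs_def)
    then have "Poly (map (\<lambda>q. poly q y) qs) = p" by simp
    moreover have "qs \<in> ?L" using q(1) by (auto simp: qs_def)
    ultimately have "qs \<in> {qs\<in>?L. F qs \<noteq> 0}" "poly (F qs) y = 0"
      using F_nonzero[of qs y] p poly_F[of qs y] by auto
    then show "y \<in> (\<Union>qs\<in>{qs\<in>?L. F qs \<noteq> 0}. {y. poly (F qs) y = 0})" by blast
  qed
  moreover have "countable (\<Union>qs\<in>{qs\<in>?L. F qs \<noteq> 0}. {y. poly (F qs) y = 0})"
  proof (rule countable_UN)
    have "countable ?L" using assms(1) by (intro countable_lists countable_poly_over)
    then show "countable {qs\<in>?L. F qs \<noteq> 0}" by (rule countable_subset[rotated]) blast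
    show "countable {y. poly (F qs) y = 0}" if "qs \<in> {qs\<in>?L. F qs \<noteq> 0}" for qs
      using that by (intro countable_finite poly_roots_finite) blast
  qed
  ultimately show ?thesis by (rule countable_subset)
qed

section \<open>Laurent polynomial functions and their specialisation\<close>

text \<open>Laurent polynomials are encoded as functions, so that matrix entries need no
  translation; the value at 0 is left free.\<close>

definition laurent :: "('a \<Rightarrow> 'a) \<Rightarrow> bool" where
  "laurent f \<longleftrightarrow> (\<exists>n p. poly_over S p \<and> (\<forall>t. t \<noteq> 0 \<longrightarrow> t ^ n * f t = poly p t))"

lemma laurentE:
  assumes "laurent f"
  obtains p n where "poly_over S p" "\<forall>t. t \<noteq> 0 \<longrightarrow> t ^ n * f t = poly p t"
  using assms unfolding laurent_def by auto

lemma laurentI: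
  "poly_over S p \<Longrightarrow> (\<And>t. t \<noteq> 0 \<Longrightarrow> t ^ n * f t = poly p t) \<Longrightarrow> laurent f"
  unfolding laurent_def by auto

lemma laurent_const: "c \<in> S \<Longrightarrow> laurent (\<lambda>_. c)"
  unfolding laurent_def by (intro exI[of _ 0] exI[of _ "[:c:]"]) auto

lemma laurent_ident: "laurent (\<lambda>t. t)"
  unfolding laurent_def by (rule exI[of _ 0], rule exI[of _ "[:0, 1:]"]) auto

lemma laurent_inverse: "laurent inverse"
  unfolding laurent_def by (rule exI[of _ 1], rule exI[of _ 1]) auto

lemma laurent_add:
  assumes "laurent f" "laurent g"
  shows "laurent (\<lambda>t. f t + g t)"
proof -
  obtain p m where p: "poly_over S p" "\<forall>t. t \<noteq> 0 \<longrightarrow> t ^ m * f t = poly p t"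
    using assms(1) by (rule laurentE)
  obtain q n where q: "poly_over S q" "\<forall>t. t \<noteq> 0 \<longrightarrow> t ^ n * g t = poly q t"
    using assms(2) by (rule laurentE)
  have "t ^ (m + n) * (f t + g t) = poly (Polynomial.monom 1 n * p + Polynomial.monom 1 m * q) t"
    if "t \<noteq> 0" for t
  proof -
    have "t ^ (m + n) * (f t + g t) = t ^ n * (t ^ m * f t) + t ^ m * (t ^ n * g t)"
      by (simp only: power_add distrib_left mult_ac)
    then show ?thesis unfolding p(2)[rule_format, OF that] q(2)[rule_format, OF that] by (simp add: poly_monom)
  qed
  then show ?thesis
    using p(1) q(1) by (intro laurentI[of "Polynomial.monom 1 n * p + Polynomial.monom 1 m * q"]) auto
qed

lemma laurent_mult:
  assumes "laurent f" "laurent g"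
  shows "laurent (\<lambda>t. f t * g t)"
proof -
  obtain p m where p: "poly_over S p" "\<forall>t. t \<noteq> 0 \<longrightarrow> t ^ m * f t = poly p t"
    using assms(1) by (rule laurentE)
  obtain q n where q: "poly_over S q" "\<forall>t. t \<noteq> 0 \<longrightarrow> t ^ n * g t = poly q t"
    using assms(2) by (rule laurentE)
  have "t ^ (m + n) * (f t * g t) = poly (p * q) t" if "t \<noteq> 0" for t
  proof -
    have "t ^ (m + n) * (f t * g t) = (t ^ m * f t) * (t ^ n * g t)"
      by (simp add: power_add)
    then show ?thesis unfolding p(2)[rule_format, OF that] q(2)[rule_format, OF that] by simp
  qed
  then show ?thesis using p(1) q(1) by (intro laurentI[of "p * q"]) auto
qed

lemma laurent_uminus: "laurent f \<Longrightarrow> laurent (\<lambda>t. - f t)"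
  using laurent_mult[OF laurent_const[of "- 1"], of f] by simp

text \<open>After multiplication by \<open>t ^ n\<close>, the equation \<open>f t = c\<close> is a
  polynomial relation over \<open>S\<close> at a transcendental point, hence an identity valid at
  every nonzero \<open>u\<close>.\<close>

lemma laurent_specialise:
  assumes f: "laurent f" and t: "\<not> algebraic_over S t" and c: "f t = c" "c \<in> S" and "u \<noteq> 0"
  shows "f u = c"
proof -
  obtain p n where p: "poly_over S p" "\<forall>t. t \<noteq> 0 \<longrightarrow> t ^ n * f t = poly p t"
    using f by (rule laurentE)
  have "t \<noteq> 0" using t algebraic_over_base[of 0] by auto
  let ?q = "p - Polynomial.monom c n"
  have "poly ?q t = 0" using p(2)[rule_format, OF \<open>t \<noteq> 0\<close>] c by (simp add: poly_monom mult.commute)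
  moreover have "poly_over S ?q" using p(1) c by simp
  ultimately have "p = Polynomial.monom c n" using t by (auto simp: algebraic_over_def)
  then have "u ^ n * f u = u ^ n * c" using p(2)[rule_format, OF \<open>u \<noteq> 0\<close>] by (simp add: poly_monom mult.commute)
  then show ?thesis using \<open>u \<noteq> 0\<close> by simp
qed

end

section \<open>Words as matrices and ping-pong\<close>

text \<open>The parameter \<open>s\<close> stands for \<open>zeta z\<close> but is not tied to any
  \<open>z\<close>. Inverses are written out, so each entry is visibly 0 or, up to sign, one of 1,
  \<open>x\<close>, \<open>y\<close>, \<open>s\<close>, \<open>inverse s\<close>.\<close>

fun letter_matrix :: "real \<Rightarrow> real \<Rightarrow> real \<Rightarrow> gen \<times> bool \<Rightarrow> real^2^2" where
  "letter_matrix x y s (GenX, False) = vector [vector [x, -1], vector [1, 0]]"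
| "letter_matrix x y s (GenX, True) = vector [vector [0, 1], vector [-1, x]]"
| "letter_matrix x y s (GenY, False) = vector [vector [0, inverse s], vector [- s, y]]"
| "letter_matrix x y s (GenY, True) = vector [vector [y, - inverse s], vector [s, 0]]"

definition word_matrix :: "real \<Rightarrow> real \<Rightarrow> real \<Rightarrow> gen word \<Rightarrow> real^2^2" where
  "word_matrix x y s w = foldr (\<lambda>a M. letter_matrix x y s a ** M) w (mat 1)"

lemma word_matrix_simps [simp]:
  "word_matrix x y s [] = mat 1"
  "word_matrix x y s (a # w) = letter_matrix x y s a ** word_matrix x y s w"
  by (simp_all add: word_matrix_def)

lemma letter_image_gen_image:
  assumes "z \<ge> 2"
  shows "letter_image SL2R (gen_image (x, y, z)) a = letter_matrix x y (zeta z) a"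
proof -
  interpret group SL2R by (rule group_SL2R)
  have nz: "zeta z \<noteq> 0" using zeta(1)[OF assms] by auto
  obtain g b where a: "a = (g, b)" by fastforce
  show ?thesis
  proof (cases b)
    case False
    then show ?thesis using a by (cases g) (simp_all add: letter_image_def)
  next
    case True
    have "inv\<^bsub>SL2R\<^esub> (gen_image (x, y, z) g) = letter_matrix x y (zeta z) (g, True)"
    proof (rule inv_equality)
      show "gen_image (x, y, z) g \<in> carrier SL2R" by (rule gen_image_closed[OF assms])
      show "letter_matrix x y (zeta z) (g, True) \<in> carrier SL2R"
        using nz by (cases g) (simp_all add: SL2R_def det_2)
      show "letter_matrix x y (zeta z) (g, True) \<otimes>\<^bsub>SL2R\<^esub> gen_image (x, y, z) g = \<one>\<^bsub>SL2R\<^esub>"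
        using nz by (cases g)
          (simp_all add: SL2R_def vec_eq_iff forall_2 matrix_matrix_mult_def sum_2 mat_def)
    qed
    then show ?thesis using a True by (simp add: letter_image_def)
  qed
qed

lemma holonomy_SL_eq_word_matrix:
  assumes "z \<ge> 2"
  shows "holonomy_SL (x, y, z) w = word_matrix x y (zeta z) w"
  unfolding holonomy_SL_def free_lift_def word_matrix_def letter_image_gen_image[OF assms]
  by (simp add: SL2R_def)

text \<open>
  Ping-pong for \<open>x = 10\<close>, \<open>y = 5/2\<close>, \<open>\<zeta> = 8\<close>.  In the coordinate \<open>m = v\<^sub>2 / v\<^sub>1\<close> on the projective
  line the form of a letter is negative exactly on the attracting interval of that letter, namely
  \<open>(-1, 1)\<close> for \<open>X\<close>, \<open>(9, 11)\<close> for its inverse, the complement of \<open>[-12, 12]\<close> for \<open>Y\<close> and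
  \<open>(2, 8)\<close> for its inverse.
\<close>

fun ping_pong_form :: "gen \<times> bool \<Rightarrow> real^2 \<Rightarrow> real" where
  "ping_pong_form (GenX, False) v = (v$2)\<^sup>2 - (v$1)\<^sup>2"
| "ping_pong_form (GenX, True) v = (v$2)\<^sup>2 - 20 * v$1 * v$2 + 99 * (v$1)\<^sup>2"
| "ping_pong_form (GenY, False) v = 144 * (v$1)\<^sup>2 - (v$2)\<^sup>2"
| "ping_pong_form (GenY, True) v = (v$2)\<^sup>2 - 10 * v$1 * v$2 + 16 * (v$1)\<^sup>2"

text \<open>Pulling the form of \<open>a\<close> back along the matrix of \<open>a\<close> gives a
  negative multiple of the form of \<open>inv_letter a\<close>; the factor is -1 for both
  \<open>GenX\<close> letters, -4 for \<open>GenY\<close> and -1/4 for its inverse.\<close>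

lemma ping_pong_form_letter_matrix:
  assumes "ping_pong_form (inv_letter a) v > 0"
  shows "ping_pong_form a (letter_matrix 10 (5/2) 8 a *v v) < 0"
proof -
  obtain g b where a: "a = (g, b)" by fastforce
  show ?thesis
    using assms unfolding a
    by (cases g; cases b)
      (simp_all add: inv_letter_def matrix_vector_mult_def sum_2 power2_eq_square algebra_simps)
qed

text \<open>This is disjointness of the attracting intervals. For each pair of forms some
  combination with positive weights is a sum of squares, so when one form is negative the other must
  be strictly positive.\<close>

lemma ping_pong_form_disjoint:
  assumes neg: "ping_pong_form a v < 0" and "b \<noteq> a"
  shows "ping_pong_form b v > 0"
proof -
  define p q where "p = v$1" and "q = v$2"
  define F where "F c = ping_pong_form c v" for c
  have F: "F (GenX, False) = q\<^sup>2 - p\<^sup>2" "F (GenX, True) = q\<^sup>2 - 20 * p * q + 99 * p\<^sup>2"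
    "F (GenY, False) = 144 * p\<^sup>2 - q\<^sup>2" "F (GenY, True) = q\<^sup>2 - 10 * p * q + 16 * p\<^sup>2"
    by (simp_all add: F_def p_def q_def)
  have 1: "2 * F (GenX, False) + F (GenX, True) \<ge> 0"
  proof -
    have "2 * F (GenX, False) + F (GenX, True) = 3 * (q - 10 / 3 * p)\<^sup>2 + 191 / 3 * p\<^sup>2"
      unfolding F by (simp add: power2_eq_square algebra_simps)
    then show ?thesis by simp
  qed
  have 2: "2 * F (GenX, False) + F (GenY, True) \<ge> 0"
  proof -
    have "2 * F (GenX, False) + F (GenY, True) = 3 * (q - 5 / 3 * p)\<^sup>2 + 17 / 3 * p\<^sup>2"
      unfolding F by (simp add: power2_eq_square algebra_simps)
    then show ?thesis by simp
  qed
  have 3: "2 * F (GenX, False) + F (GenY, False) \<ge> 0"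
  proof -
    have "2 * F (GenX, False) + F (GenY, False) = q\<^sup>2 + 142 * p\<^sup>2"
      unfolding F by (simp add: power2_eq_square algebra_simps)
    then show ?thesis by simp
  qed
  have 4: "10 * F (GenX, True) + F (GenY, False) \<ge> 0"
  proof -
    have "10 * F (GenX, True) + F (GenY, False) = 9 * (q - 100 / 9 * p)\<^sup>2 + 206 / 9 * p\<^sup>2"
      unfolding F by (simp add: power2_eq_square algebra_simps)
    then show ?thesis by simp
  qed
  have 5: "4 * F (GenY, True) + F (GenY, False) \<ge> 0"
  proof -
    have "4 * F (GenY, True) + F (GenY, False) = 3 * (q - 20 / 3 * p)\<^sup>2 + 224 / 3 * p\<^sup>2"
      unfolding F by (simp add: power2_eq_square algebra_simps)
    then show ?thesis by simp
  qed
  have 6: "F (GenX, True) + F (GenY, True) \<ge> 0"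
  proof -
    have "F (GenX, True) + F (GenY, True) = 2 * (q - 15 / 2 * p)\<^sup>2 + 5 / 2 * p\<^sup>2"
      unfolding F by (simp add: power2_eq_square algebra_simps)
    then show ?thesis by simp
  qed
  obtain g s h t where ab: "a = (g, s)" "b = (h, t)" by fastforce
  have "F a < 0" using neg by (simp add: F_def)
  then have "F b > 0"
    using \<open>b \<noteq> a\<close> 1 2 3 4 5 6 unfolding ab by (cases g; cases s; cases h; cases t) auto
  then show ?thesis by (simp add: F_def)
qed

text \<open>Its slope 3/2 lies outside the closures of all four attracting intervals.\<close>

definition base_vector :: "real^2" where
  "base_vector = vector [2, 3]"

lemma ping_pong_form_base_vector: "ping_pong_form a base_vector > 0"
proof -
  obtain g b where a: "a = (g, b)" by fastforce
  show ?thesis unfolding a by (cases g; cases b) (simp_all add: base_vector_def)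
qed

text \<open>The last letter moves the base vector into its own interval. Since the word is reduced,
  each interval reached differs from that of the inverse of the next letter applied, which therefore
  maps it into its own interval.\<close>

lemma ping_pong:
  "reduced (a # w) \<Longrightarrow> ping_pong_form a (word_matrix 10 (5/2) 8 (a # w) *v base_vector) < 0"
proof (induction w arbitrary: a)
  case Nil
  show ?case
    using ping_pong_form_letter_matrix[OF ping_pong_form_base_vector, of a] by simp
next
  case (Cons b w)
  have "reduced (b # w)" "b \<noteq> inv_letter a" using Cons.prems by (auto simp: reduced_Cons)
  then have "ping_pong_form (inv_letter a) (word_matrix 10 (5/2) 8 (b # w) *v base_vector) > 0"
    using Cons.IH[of b] ping_pong_form_disjoint[of b _ "inv_letter a"] by metis
  from ping_pong_form_letter_matrix[OF this] show ?case
    by (simp only: word_matrix_simps matrix_vector_mul_assoc)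
qed

text \<open>Quadratic forms do not distinguish \<open>v\<close> from \<open>- v\<close>, so a matrix
  in \<open>pm_id\<close> would keep the form at the base vector positive, against
  \<open>ping_pong\<close>.\<close>

lemma word_matrix_special_notin_pm_id:
  assumes "reduced w" "w \<noteq> []"
  shows "word_matrix 10 (5/2) 8 w \<notin> pm_id"
proof
  assume *: "word_matrix 10 (5/2) 8 w \<in> pm_id"
  obtain a u where w: "w = a # u" using assms(2) by (cases w) auto
  have form_uminus: "ping_pong_form a (- v) = ping_pong_form a v" for v
  proof -
    obtain g b where a: "a = (g, b)" by fastforce
    show ?thesis unfolding a by (cases g; cases b) simp_all
  qed
  have neg: "(- mat 1) *v v = - v" for v :: "real^2"
    by (simp add: vec_eq_iff forall_2 matrix_vector_mult_def sum_2 mat_def)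
  have "ping_pong_form a (word_matrix 10 (5/2) 8 w *v base_vector) < 0"
    using ping_pong assms(1) unfolding w by blast
  moreover have "ping_pong_form a (word_matrix 10 (5/2) 8 w *v base_vector) = ping_pong_form a base_vector"
    using * by (auto simp: pm_id_def neg form_uminus)
  ultimately show False using ping_pong_form_base_vector[of a] by simp
qed

section \<open>Generic points\<close>

text \<open>With three functions as parameters, one statement covers varying any single parameter.
  The inverse of \<open>h\<close> is a separate assumption because the reciprocal of a Laurent
  polynomial need not be one.\<close>

lemma laurent_word_matrix:
  fixes S :: "real set"
  assumes "field_subring S"
    and laur: "field_subring.laurent S f" "field_subring.laurent S g" "field_subring.laurent S h"
      "field_subring.laurent S (\<lambda>t. inverse (h t))"
  shows "field_subring.laurent S (\<lambda>t. word_matrix (f t) (g t) (h t) w $ i $ j)"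
proof (induction w arbitrary: i j)
  interpret field_subring S by fact
  case Nil
  show ?case by (auto simp: mat_def intro: laurent_const)
next
  interpret field_subring S by fact
  case (Cons a w)
  obtain c b where a: "a = (c, b)" by fastforce
  have "laurent (\<lambda>t. letter_matrix (f t) (g t) (h t) a $ k $ l)" for k l
    using exhaust_2[of k] exhaust_2[of l] unfolding a
    by (cases c; cases b) (auto intro!: laur laurent_const laurent_uminus)
  then show ?case
    using Cons.IH by (simp add: matrix_matrix_mult_def sum_2 laurent_add laurent_mult)
qed

text \<open>The entries of a matrix in \<open>pm_id\<close> are 0, 1 or -1 and so lie in
  \<open>S\<close>; thus \<open>laurent_specialise\<close> fixes each entry.\<close>

lemma word_matrix_specialise:
  fixes S :: "real set"
  assumes S: "field_subring S"
    and laur: "field_subring.laurent S f" "field_subring.laurent S g" "field_subring.laurent S h"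
      "field_subring.laurent S (\<lambda>t. inverse (h t))"
    and t: "\<not> algebraic_over S t" and "u \<noteq> 0"
    and pm: "word_matrix (f t) (g t) (h t) w \<in> pm_id"
  shows "word_matrix (f u) (g u) (h u) w \<in> pm_id"
proof -
  interpret field_subring S by fact
  define M where "M = word_matrix (f t) (g t) (h t) w"
  have "M $ i $ j \<in> S" for i j
    using pm unfolding M_def[symmetric] by (auto simp: pm_id_def mat_def)
  then have "word_matrix (f u) (g u) (h u) w $ i $ j = M $ i $ j" for i j
    using laurent_specialise[OF laurent_word_matrix[OF S laur] t _ _ \<open>u \<noteq> 0\<close>, of w i j] by (simp add: M_def)
  then have "word_matrix (f u) (g u) (h u) w = M" by (simp add: vec_eq_iff)
  with pm show ?thesis by (simp add: M_def)
qed

lemma field_subring_Rats: "field_subring (\<rat> :: real set)"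
  by unfold_locales auto

lemma word_matrix_generic_notin_pm_id:
  assumes x: "\<not> algebraic_over \<rat> x" and y: "\<not> algebraic_over (adjoin \<rat> x) y"
    and s: "\<not> algebraic_over (adjoin (adjoin \<rat> x) y) s"
    and w: "reduced w" "w \<noteq> []"
  shows "word_matrix x y s w \<notin> pm_id"
proof
  interpret Q: field_subring "\<rat> :: real set" by (rule field_subring_Rats)
  interpret Q1: field_subring "adjoin \<rat> x" by (rule Q.field_subring_adjoin)
  interpret Q2: field_subring "adjoin (adjoin \<rat> x) y" by (rule Q1.field_subring_adjoin)
  have x_mem: "x \<in> adjoin \<rat> x" "x \<in> adjoin (adjoin \<rat> x) y" and y_mem: "y \<in> adjoin (adjoin \<rat> x) y"
    by (simp_all add: Q.generator_mem_adjoin Q1.generator_mem_adjoin Q1.mem_adjoin)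
  have rat_mem: "5 / 2 \<in> adjoin \<rat> x" "8 \<in> adjoin \<rat> x" "inverse 8 \<in> adjoin \<rat> x"
    by (simp_all add: Q.mem_adjoin)
  assume "word_matrix x y s w \<in> pm_id"
  \<comment> \<open>The parameters are replaced in the order \<open>s\<close>, \<open>y\<close>,
    \<open>x\<close>: each is transcendental over the ring generated by those not yet
    replaced.\<close>
  with s have "word_matrix x y 8 w \<in> pm_id"
    using word_matrix_specialise[OF Q2.field_subring_axioms Q2.laurent_const Q2.laurent_const
      Q2.laurent_ident Q2.laurent_inverse, of x y s 8 w] x_mem y_mem by simp
  with y have "word_matrix x (5/2) 8 w \<in> pm_id"
    using word_matrix_specialise[OF Q1.field_subring_axioms Q1.laurent_const Q1.laurent_ident
      Q1.laurent_const Q1.laurent_const, of x 8 y "5/2" w] x_mem rat_mem by simp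
  with x have "word_matrix 10 (5/2) 8 w \<in> pm_id"
    using word_matrix_specialise[OF Q.field_subring_axioms Q.laurent_ident Q.laurent_const
      Q.laurent_const Q.laurent_const, of "5/2" 8 x 10 w] by simp
  with word_matrix_special_notin_pm_id[OF w] show False by blast
qed

text \<open>
  For fixed \<open>x, y\<close> the equation is quadratic in \<open>z\<close>, with discriminant
  \<open>(x\<^sup>2 - 4) (y\<^sup>2 - 4) + 4 k - 8\<close>. It increases with \<open>x\<close> and \<open>y\<close>, so from any point of the surface
  \<open>x\<close> and \<open>y\<close> can be increased independently, even where the discriminant vanishes.
\<close>

lemma obtain_generic_point:
  fixes x0 y0 z0 k :: real
  assumes k: "\<not> algebraic_over \<rat> k"
    and gt: "x0 > 2" "y0 > 2" "z0 > 2"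
    and eq: "x0\<^sup>2 + y0\<^sup>2 + z0\<^sup>2 - x0 * y0 * z0 - 2 = k"
    and U: "open U" "(x0, y0, z0) \<in> U"
  obtains x y z where "(x, y, z) \<in> U" "x > 2" "y > 2" "z > 2"
    "x\<^sup>2 + y\<^sup>2 + z\<^sup>2 - x * y * z - 2 = k"
    "\<not> algebraic_over \<rat> x" "\<not> algebraic_over (adjoin \<rat> x) y"
    "\<not> algebraic_over (adjoin (adjoin \<rat> x) y) k"
proof -
  interpret Q: field_subring "\<rat> :: real set" by (rule field_subring_Rats)
  define D where "D x y = (x\<^sup>2 - 4) * (y\<^sup>2 - 4) + 4 * k - 8" for x y :: real
  \<comment> \<open>The sign selects the root of the quadratic in \<open>z\<close> that equals
    \<open>z0\<close> at \<open>(x0, y0)\<close>.\<close>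
  define \<sigma> :: real where "\<sigma> = (if 2 * z0 \<ge> x0 * y0 then 1 else -1)"
  \<comment> \<open>Since \<open>sqrt\<close> is total and continuous on all reals, \<open>g\<close>
    is continuous on the whole plane; its values lie on the surface only where \<open>D\<close> is
    nonnegative.\<close>
  define g where "g p = (fst p, snd p, (fst p * snd p + \<sigma> * sqrt (D (fst p) (snd p))) / 2)" for p
  have "D x0 y0 = (2 * z0 - x0 * y0)\<^sup>2"
    unfolding D_def eq[symmetric] by (simp add: power2_eq_square algebra_simps)
  then have D0: "D x0 y0 \<ge> 0" and "\<sigma> * sqrt (D x0 y0) = 2 * z0 - x0 * y0"
    by (auto simp: \<sigma>_def)
  then have g0: "g (x0, y0) = (x0, y0, z0)" by (simp add: g_def)
  have "continuous_on UNIV g" unfolding g_def D_def by (intro continuous_intros) auto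
  moreover have "open (U \<inter> {2<..} \<times> {2<..} \<times> {2<..})"
    using U(1) by (intro open_Int open_Times) auto
  ultimately have "open (g -` (U \<inter> {2<..} \<times> {2<..} \<times> {2<..}))"
    by (intro open_vimage)
  moreover have "(x0, y0) \<in> g -` (U \<inter> {2<..} \<times> {2<..} \<times> {2<..})"
    using g0 U(2) gt by simp
  ultimately obtain A B where AB: "open A" "open B" "(x0, y0) \<in> A \<times> B"
    "A \<times> B \<subseteq> g -` (U \<inter> {2<..} \<times> {2<..} \<times> {2<..})"
    by (rule open_prod_elim)
  \<comment> \<open>The choice is strictly to the right of \<open>t0\<close>, so that
    \<open>D\<close> cannot fall below \<open>D x0 y0\<close>.\<close>
  have pick: "\<exists>t. t > t0 \<and> t \<in> T \<and> t \<notin> N" if T: "open T" "t0 \<in> T" "countable N" for t0 :: real and T N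
  proof -
    obtain b where "t0 < b" "{t0..<b} \<subseteq> T"
      using open_right[OF T(1,2), of "t0 + 1"] by auto
    then have "uncountable {t0<..<b}" by (simp add: uncountable_open_interval)
    then have "\<not> {t0<..<b} \<subseteq> N" using T(3) countable_subset by blast
    then obtain t where "t \<in> {t0<..<b}" "t \<notin> N" by blast
    with \<open>{t0..<b} \<subseteq> T\<close> show ?thesis by (intro exI[of _ t]) auto
  qed
  \<comment> \<open>Avoiding the second set keeps \<open>k\<close> transcendental over Q[x], as the
    exchange argument for \<open>y\<close> requires.\<close>
  have "countable ({x. algebraic_over \<rat> x} \<union> {x. algebraic_over (adjoin \<rat> x) k})"
    using Q.countable_algebraic_over Q.countable_exchange[OF _ k] by (simp add: countable_rat)
  then obtain x where x: "x > x0" "x \<in> A" "\<not> algebraic_over \<rat> x" "\<not> algebraic_over (adjoin \<rat> x) k"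
    using pick[OF AB(1), of x0] AB(3) by blast
  interpret Q1: field_subring "adjoin \<rat> x" by (rule Q.field_subring_adjoin)
  have "countable (adjoin \<rat> x)" by (intro Q.countable_adjoin countable_rat)
  then have "countable ({y. algebraic_over (adjoin \<rat> x) y} \<union>
      {y. algebraic_over (adjoin (adjoin \<rat> x) y) k})"
    using Q1.countable_algebraic_over Q1.countable_exchange[OF _ x(4)] by simp
  then obtain y where y: "y > y0" "y \<in> B" "\<not> algebraic_over (adjoin \<rat> x) y"
    "\<not> algebraic_over (adjoin (adjoin \<rat> x) y) k"
    using pick[OF AB(2), of y0] AB(3) by blast
  define z where "z = (x * y + \<sigma> * sqrt (D x y)) / 2"
  have "g (x, y) = (x, y, z)" by (simp add: g_def z_def)
  moreover have "g (x, y) \<in> U \<inter> {2<..} \<times> {2<..} \<times> {2<..}" using AB(4) x(2) y(2) by blast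
  ultimately have mem: "(x, y, z) \<in> U" "x > 2" "y > 2" "z > 2" by auto
  have "D x0 y0 \<le> D x y"
    unfolding D_def using x(1) y(1) gt power_mono[of 2 x 2] power_mono[of 2 y0 2]
    by (auto intro!: mult_mono power_mono)
  then have "(sqrt (D x y))\<^sup>2 = D x y" using D0 by simp
  moreover have "\<sigma>\<^sup>2 = 1" by (simp add: \<sigma>_def)
  moreover have "(2 * z - x * y)\<^sup>2 = \<sigma>\<^sup>2 * (sqrt (D x y))\<^sup>2" by (simp add: z_def power_mult_distrib)
  ultimately have "(2 * z - x * y)\<^sup>2 = (x\<^sup>2 - 4) * (y\<^sup>2 - 4) + 4 * k - 8" by (simp add: D_def)
  then have "x\<^sup>2 + y\<^sup>2 + z\<^sup>2 - x * y * z - 2 = k"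
    by (simp add: power2_eq_square algebra_simps)
  with mem x y show ?thesis by (intro that)
qed

section \<open>Continuity of the holonomy in the parameters\<close>

text \<open>Because \<open>zeta z\<close> is at least 1, the square root is
  \<open>zeta z - inverse (zeta z)\<close>. Continuity of \<open>zeta\<close> is read off from this
  closed form.\<close>

lemma zeta_eq:
  assumes "z \<ge> 2"
  shows "zeta z = (z + sqrt (z\<^sup>2 - 4)) / 2"
proof -
  note z = zeta[OF assms]
  have "(zeta z + inverse (zeta z))\<^sup>2 - 4 = (zeta z - inverse (zeta z))\<^sup>2"
  proof -
    have "(q + r)\<^sup>2 - 4 = (q - r)\<^sup>2 + 4 * (q * r) - 4" for q r :: real
      by (simp add: power2_eq_square algebra_simps)
    moreover have "zeta z * inverse (zeta z) = 1" using z(1) by simp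
    ultimately show ?thesis by simp
  qed
  moreover have "inverse (zeta z) \<le> zeta z" using z(1) le_imp_inverse_le[of 1 "zeta z"] by simp
  ultimately have "sqrt (z\<^sup>2 - 4) = zeta z - inverse (zeta z)" unfolding z(2) by simp
  with z(2) show ?thesis by simp
qed

lemma continuous_on_matrix_mult:
  fixes A B :: "'a::topological_space \<Rightarrow> real^2^2"
  assumes "continuous_on S A" "continuous_on S B"
  shows "continuous_on S (\<lambda>\<xi>. A \<xi> ** B \<xi>)"
  unfolding matrix_matrix_mult_def using assms by (intro continuous_intros)

lemma continuous_on_holonomy_SL:
  assumes "\<And>x y z. (x, y, z) \<in> S \<Longrightarrow> z \<ge> 2"
  shows "continuous_on S (\<lambda>\<xi>. holonomy_SL \<xi> w)"
proof -
  let ?x = "\<lambda>\<xi> :: real \<times> real \<times> real. fst \<xi>" and ?y = "\<lambda>\<xi>. fst (snd \<xi>)" and ?s = "\<lambda>\<xi>. zeta (snd (snd \<xi>))"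
  have ge: "snd (snd \<xi>) \<ge> 2" if "\<xi> \<in> S" for \<xi>
    using assms[of "fst \<xi>" "fst (snd \<xi>)" "snd (snd \<xi>)"] that by simp
  have "continuous_on S (\<lambda>\<xi>. (snd (snd \<xi>) + sqrt ((snd (snd \<xi>))\<^sup>2 - 4)) / 2)"
    by (intro continuous_intros) auto
  then have s: "continuous_on S ?s"
    by (rule continuous_on_eq) (use ge in \<open>simp add: zeta_eq\<close>)
  have inv_s: "continuous_on S (\<lambda>\<xi>. inverse (?s \<xi>))"
    using s by (rule continuous_on_inverse) (use zeta(1)[OF ge] in force)
  have xy: "continuous_on S ?x" "continuous_on S ?y" by (intro continuous_intros)+
  have entry: "continuous_on S (\<lambda>\<xi>. letter_matrix (?x \<xi>) (?y \<xi>) (?s \<xi>) a $ i $ j)" for a i j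
  proof -
    obtain c b where a: "a = (c, b)" by fastforce
    show ?thesis
      using exhaust_2[of i] exhaust_2[of j] unfolding a
      by (elim disjE; cases c; cases b) (simp_all add: xy s inv_s continuous_on_minus)
  qed
  have "continuous_on S (\<lambda>\<xi>. \<chi> i j. letter_matrix (?x \<xi>) (?y \<xi>) (?s \<xi>) a $ i $ j)" for a
    by (intro continuous_on_vec_lambda entry)
  then have "continuous_on S (\<lambda>\<xi>. letter_matrix (?x \<xi>) (?y \<xi>) (?s \<xi>) a)" for a by simp
  then have "continuous_on S (\<lambda>\<xi>. word_matrix (?x \<xi>) (?y \<xi>) (?s \<xi>) w)"
    by (induction w) (auto intro: continuous_on_matrix_mult)
  then show ?thesis
    by (rule continuous_on_eq) (use ge in \<open>auto simp: holonomy_SL_eq_word_matrix\<close>)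
qed

section \<open>Injectivity from a trivial kernel, and the dense set of faithful points\<close>

text \<open>The identity of \<open>PSL2R\<close> is the coset \<open>pm_id\<close>, and a matrix
  lies in its own coset, so a word in the kernel has its matrix in \<open>pm_id\<close>.\<close>

lemma inj_on_holonomy:
  assumes "z \<ge> 2" and "\<And>w. reduced w \<Longrightarrow> w \<noteq> [] \<Longrightarrow> holonomy_SL (x, y, z) w \<notin> pm_id"
  shows "inj_on (holonomy (x, y, z)) (carrier F2)"
proof -
  interpret group_hom F2 PSL2R "holonomy (x, y, z)"
    by (intro group_hom.intro group_hom_axioms.intro group_free_group group_PSL2R holonomy_hom assms(1))
  interpret S: group SL2R by (rule group_SL2R)
  have "w = []" if w: "reduced w" "holonomy (x, y, z) w = pm_id" for w
  proof (rule ccontr)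
    assume "w \<noteq> []"
    have "holonomy_SL (x, y, z) w \<in> carrier SL2R"
      using hom_in_carrier[OF holonomy_SL_hom[OF assms(1)], of w] w(1) by (simp add: free_group_def)
    then have "holonomy_SL (x, y, z) w \<in> proj_PSL2R (holonomy_SL (x, y, z) w)"
      unfolding proj_PSL2R_def
      by (intro S.rcos_self normal_imp_subgroup[OF normal_pm_id])
    with w(2) have "holonomy_SL (x, y, z) w \<in> pm_id" by (simp add: holonomy_def)
    with assms(2)[OF w(1) \<open>w \<noteq> []\<close>] show False by blast
  qed
  then have "kernel F2 PSL2R (holonomy (x, y, z)) \<subseteq> {\<one>\<^bsub>F2\<^esub>}"
    by (auto simp: kernel_def free_group_def PSL2R_def FactGroup_def)
  moreover have "\<one>\<^bsub>F2\<^esub> \<in> kernel F2 PSL2R (holonomy (x, y, z))"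
    by (simp add: kernel_def)
  ultimately show ?thesis by (intro trivial_ker_imp_inj) blast
qed

lemma countable_words: "countable (UNIV :: gen word set)"
proof -
  have "(UNIV :: gen set) = {GenX, GenY}" using gen.exhaust by auto
  then have "finite (UNIV :: gen set)" by (metis finite.emptyI finite.insertI)
  then have "countable (UNIV :: (gen \<times> bool) set)"
    unfolding UNIV_Times_UNIV[symmetric] by (intro countable_finite finite_cartesian_product) auto
  from countable_lists[OF this] show ?thesis by (simp add: lists_UNIV)
qed

theorem theorem1p2:
  fixes \<theta> :: real
  assumes "0 < \<theta>" and "\<theta> < 2 * pi"
    and "\<not> algebraic (cos \<theta>)"
  shows "very_general (top_of_set (fricke_klein \<theta>)) (\<lambda>\<xi>. inj_on (holonomy \<xi>) (carrier F2))"
proof -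
  interpret Q: field_subring "\<rat> :: real set" by (rule field_subring_Rats)
  define k where "k = - 2 * cos (\<theta> / 2)"
  let ?C = "fricke_klein \<theta>"
  have C: "(x, y, z) \<in> ?C \<longleftrightarrow> x > 2 \<and> y > 2 \<and> z > 2 \<and> x\<^sup>2 + y\<^sup>2 + z\<^sup>2 - x * y * z - 2 = k" for x y z
    by (simp add: fricke_klein_def k_def)
  have k: "\<not> algebraic_over \<rat> k"
  proof
    assume "algebraic_over \<rat> k"
    \<comment> \<open>By the double-angle formula \<open>cos \<theta>\<close> is this polynomial in
      \<open>k\<close>.\<close>
    then have "algebraic_over \<rat> (k * k * (1 / 2) + - 1)"
      by (intro Q.algebraic_over_closed) (auto intro: Q.algebraic_over_base)
    moreover have "k * k * (1 / 2) + - 1 = cos \<theta>"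
      using cos_double_cos[of "\<theta> / 2"] by (simp add: k_def power2_eq_square)
    ultimately show False using assms(3) by (simp add: algebraic_over_Rats)
  qed
  define W where "W = {w :: gen word. reduced w \<and> w \<noteq> []}"
  define good where "good w = {\<xi> \<in> ?C. holonomy_SL \<xi> w \<notin> pm_id}" for w
  have "openin (top_of_set ?C) (good w)" for w
  proof -
    have "continuous_on ?C (\<lambda>\<xi>. holonomy_SL \<xi> w)" by (rule continuous_on_holonomy_SL) (auto simp: C)
    moreover have "open (- pm_id)" by (auto simp: pm_id_def intro!: open_Compl finite_imp_closed)
    ultimately have "openin (top_of_set ?C) (?C \<inter> (\<lambda>\<xi>. holonomy_SL \<xi> w) -` (- pm_id))"
      by (rule continuous_openin_preimage_gen)
    moreover have "?C \<inter> (\<lambda>\<xi>. holonomy_SL \<xi> w) -` (- pm_id) = good w" by (auto simp: good_def)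
    ultimately show ?thesis by simp
  qed
  \<comment> \<open>A member of \<open>W\<close> makes the intersection a nonempty one, hence
    contained in the surface; it also yields \<open>z \<ge> 2\<close> at the end.\<close>
  moreover have "[(GenX, False)] \<in> W" by (simp add: W_def reduced_Cons)
  moreover have "countable W" using countable_words by (rule countable_subset[rotated]) simp
  ultimately have "gdelta_in (top_of_set ?C) (\<Inter>w\<in>W. good w)"
    by (intro gdelta_in_Inter) (auto intro: open_imp_gdelta_in)
  moreover have "top_of_set ?C closure_of (\<Inter>w\<in>W. good w) = topspace (top_of_set ?C)"
    \<comment> \<open>One generic point in each nonempty open set lies in all sets
      \<open>good w\<close> at once.\<close>
    unfolding dense_intersects_open
  proof (intro allI impI)
    fix T assume T: "openin (top_of_set ?C) T \<and> T \<noteq> {}"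
    then obtain U where U: "open U" "T = ?C \<inter> U" by (auto simp: openin_open)
    with T obtain x0 y0 z0 where "(x0, y0, z0) \<in> ?C" "(x0, y0, z0) \<in> U" by auto
    then obtain x y z where xyz: "(x, y, z) \<in> U" "x > 2" "y > 2" "z > 2"
      "x\<^sup>2 + y\<^sup>2 + z\<^sup>2 - x * y * z - 2 = k"
      "\<not> algebraic_over \<rat> x" "\<not> algebraic_over (adjoin \<rat> x) y"
      "\<not> algebraic_over (adjoin (adjoin \<rat> x) y) k"
      using obtain_generic_point[OF k _ _ _ _ U(1)] by (metis C)
    interpret Q1: field_subring "adjoin \<rat> x" by (rule Q.field_subring_adjoin)
    interpret Q2: field_subring "adjoin (adjoin \<rat> x) y" by (rule Q1.field_subring_adjoin)
    let ?S = "adjoin (adjoin \<rat> x) y"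
    \<comment> \<open>Otherwise \<open>z\<close>, and then \<open>k\<close> through the equation of
      the surface, would be algebraic over \<open>?S\<close>.\<close>
    have "\<not> algebraic_over ?S (zeta z)"
    proof
      assume *: "algebraic_over ?S (zeta z)"
      note cl = Q2.algebraic_over_closed
      have x: "algebraic_over ?S x"
        by (intro Q2.algebraic_over_base Q1.mem_adjoin Q.generator_mem_adjoin)
      have y: "algebraic_over ?S y" by (intro Q2.algebraic_over_base Q1.generator_mem_adjoin)
      have "algebraic_over ?S (zeta z + inverse (zeta z))" using * by (intro cl)
      then have z: "algebraic_over ?S z" using zeta(2)[of z] xyz(4) by simp
      have "algebraic_over ?S (x * x + y * y + z * z + - (x * y * z) + - (1 + 1))"
        by (intro cl x y z) (intro Q2.algebraic_over_base Q2.one_mem)+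
      moreover have "x * x + y * y + z * z + - (x * y * z) + - (1 + 1) = k"
        using xyz(5) by (simp add: power2_eq_square)
      ultimately show False using xyz(8) by simp
    qed
    then have "word_matrix x y (zeta z) w \<notin> pm_id" if "w \<in> W" for w
      using word_matrix_generic_notin_pm_id[OF xyz(6,7)] that by (auto simp: W_def)
    then have "(x, y, z) \<in> (\<Inter>w\<in>W. good w) \<inter> T"
      using xyz(1-5) U(2) by (auto simp: good_def C holonomy_SL_eq_word_matrix)
    then show "(\<Inter>w\<in>W. good w) \<inter> T \<noteq> {}" by blast
  qed
  moreover have "inj_on (holonomy \<xi>) (carrier F2)" if \<xi>: "\<xi> \<in> (\<Inter>w\<in>W. good w)" for \<xi>
  proof -
    obtain x y z where [simp]: "\<xi> = (x, y, z)" by (cases \<xi>)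
    have "\<xi> \<in> good [(GenX, False)]" using \<xi> \<open>[(GenX, False)] \<in> W\<close> by blast
    then have "z \<ge> 2" by (simp add: good_def C)
    then show ?thesis using \<xi> by (auto intro!: inj_on_holonomy simp: W_def good_def)
  qed
  ultimately show ?thesis unfolding very_general_def by blast
qed

end
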